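(* There exists a magic knight's tour in the $5$-dimensional $4 \times 4 \times 4 \times 4 \times 4$ hypercube.
   Context: The $4\times 4\times 4\times 4\times 4$ hypercube is the lattice of $1024$ cells $\{1,2,3,4\}^5$. A knight's move goes from one cell to another cell such that their coordinates differ by exactly $2$ in absolute value in one coordinate, by exactly $1$ in absolute value in another coordinate, and agree in all remaining coordinates. A knight's tour is a sequence of knight's moves that visits every cell exactly once; the cells are numbered $1,2,\dots,1024$ in the order in which they are visited. A line is a set of $4$ cells obtained by fixing four of the coordinates and letting the remaining coordinate run over $1,\dots,4$. A knight's tour (open or closed) is magic if the sum of the numbers is the same for every line (space diagonals are not required to have this sum). *)

theory Defs
  imports Main
begin

type_synonym cell = "int list"

definition cells :: "cell set" where
  "cells = {c. length c = 5 \<and> set c \<subseteq> {1..4}}"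

definition knight_move :: "cell \<Rightarrow> cell \<Rightarrow> bool" where
  "knight_move c d \<longleftrightarrow> c \<in> cells \<and> d \<in> cells \<and>
     (\<exists>i<5. \<exists>j<5. i \<noteq> j \<and> \<bar>c ! i - d ! i\<bar> = 2 \<and> \<bar>c ! j - d ! j\<bar> = 1 \<and>
        (\<forall>k<5. k \<noteq> i \<longrightarrow> k \<noteq> j \<longrightarrow> c ! k = d ! k))"

(* The tour may be open or closed: nothing is asked of the step from the last cell to the first. *)
definition knights_tour :: "cell list \<Rightarrow> bool" where
  "knights_tour t \<longleftrightarrow> distinct t \<and> set t = cells \<and> successively knight_move t"

(* List positions start at 0, the numbering of the cells starts at 1. *)
definition cell_number :: "cell list \<Rightarrow> cell \<Rightarrow> nat" where
  "cell_number t c = Suc (inv_into {..<length t} ((!) t) c)"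

definition lines :: "cell set set" where
  "lines = {{d \<in> cells. \<forall>k<5. k \<noteq> i \<longrightarrow> d ! k = c ! k} | c i. c \<in> cells \<and> i < 5}"

definition magic :: "cell list \<Rightarrow> bool" where
  "magic t \<longleftrightarrow> (\<exists>s. \<forall>L\<in>lines. (\<Sum>c\<in>L. cell_number t c) = s)"

end

theory Submission
  imports Defs
begin

text \<open>
  Read the coordinates \<open>1, 2, 3, 4\<close> as the 2-bit vectors \<open>0, 1, 2, 3\<close> over GF(2).  Adding \<open>2\<close>
  changes a coordinate by exactly \<open>2\<close> and adding \<open>1\<close> changes it by exactly \<open>1\<close>, so adding \<open>2\<close> in
  one place and \<open>1\<close> in another is always a knight's move.  The tour is the image of \<open>0, 1, \<dots>, 1023\<close>,
  read as 10-bit vectors, under a linear bijection.  Consecutive times differ by the vector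
  \<open>2 ^ (k + 1) - 1\<close> for some \<open>k \<le> 9\<close>, so only ten differences of cells occur.  Nine of them are of
  the above form and span a hyperplane; the tenth, used only in the middle of the tour, adds \<open>2\<close> in
  one place and \<open>3\<close> in another, which is a knight's move there because the latter coordinate passes
  between \<open>2\<close> and \<open>3\<close>.  The bijection is chosen such that each bit of the time depends nontrivially
  on each single coordinate; hence each bit is set on exactly two cells of every line.
\<close>

section \<open>Two-bit coordinates and linear times\<close>

definition vectors :: "int list set" where
  "vectors = {v. length v = 5 \<and> set v \<subseteq> {0, 1, 2, 3}}"

definition cell_of :: "int list \<Rightarrow> cell" where
  "cell_of v = map (\<lambda>x. x + 1) v"

definition vector_of :: "cell \<Rightarrow> int list" where
  "vector_of c = map (\<lambda>x. x - 1) c"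

text \<open>
  The times of the unit vectors: the \<open>i\<close>-th pair belongs to the vectors with the single nonzero
  coordinate \<open>1\<close> resp. \<open>2\<close> at place \<open>i\<close>.  Each pair has bitwise disjunction \<open>1023\<close>, which is what
  makes every bit depend on every coordinate.
\<close>

definition weights :: "(nat \<times> nat) list" where
  "weights = [(751, 816), (1011, 846), (847, 752), (783, 1020), (759, 780)]"

fun weight :: "nat \<times> nat \<Rightarrow> int \<Rightarrow> nat" where
  "weight (p, q) x = xor (if bit x 0 then p else 0) (if bit x 1 then q else 0)"

text \<open>The inverse of the linear bijection from times, counted from \<open>0\<close>, to cells.\<close>

definition time :: "int list \<Rightarrow> nat" where
  "time v = foldr xor (map2 weight weights v) 0"

text \<open>Phrased with \<open>xor\<close> instead of absolute differences so that translations
  preserve it. Steps between 1 and 2, whose \<open>xor\<close> is 3, are thereby excluded: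
  translating them can produce a difference of 3.\<close>

definition linear_move :: "int list \<Rightarrow> int list \<Rightarrow> bool" where
  "linear_move u v \<longleftrightarrow>
     (\<exists>i<5. \<exists>j<5. i \<noteq> j \<and> xor (u ! i) (v ! i) = 2 \<and> xor (u ! j) (v ! j) = 1 \<and>
        (\<forall>k<5. k \<noteq> i \<longrightarrow> k \<noteq> j \<longrightarrow> u ! k = v ! k))"

text \<open>Prescribing the times in order also forces the entries of \<open>vs\<close> to be
  distinct.\<close>

definition timed :: "nat \<Rightarrow> int list list \<Rightarrow> bool" where
  "timed k vs \<longleftrightarrow> set vs \<subseteq> vectors \<and> map time vs = [0..<2 ^ k]"

definition linear_path :: "nat \<Rightarrow> int list \<Rightarrow> int list list \<Rightarrow> bool" where
  "linear_path k v vs \<longleftrightarrow>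
     timed k vs \<and> successively linear_move vs \<and> hd vs = [0, 0, 0, 0, 0] \<and> last vs = v"

lemma vectorsE:
  assumes "v \<in> vectors"
  obtains a b c d e where "v = [a, b, c, d, e]"
  using assms by (auto simp: vectors_def length_Suc_conv eval_nat_numeral)

lemma ex_less_5: "(\<exists>i<5. P i) \<longleftrightarrow> P 0 \<or> P 1 \<or> P 2 \<or> P 3 \<or> P (4 :: nat)"
  by (simp add: eval_nat_numeral Ex_less_Suc disj_ac)

lemma all_less_5: "(\<forall>i<5. P i) \<longleftrightarrow> P 0 \<and> P 1 \<and> P 2 \<and> P 3 \<and> P (4 :: nat)"
  by (simp add: eval_nat_numeral All_less_Suc conj_ac)

section \<open>Linearity of \<open>time\<close> over GF(2)\<close>

lemma xor_cancel_left: "xor a (xor a b) = b" for a b :: "'a :: semiring_bit_operations"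
  by (simp flip: xor.assoc)

lemma xor_in_vectors:
  assumes "b \<in> vectors" "v \<in> vectors"
  shows "map2 xor b v \<in> vectors"
proof -
  have "xor x y \<in> {0, 1, 2, 3}" if "(x, y) \<in> set (zip b v)" for x y
  proof -
    have "x \<in> {0, 1, 2, 3}"
      using assms(1) set_zip_leftD[OF that] by (auto simp: vectors_def)
    moreover have "y \<in> {0, 1, 2, 3}"
      using assms(2) set_zip_rightD[OF that] by (auto simp: vectors_def)
    ultimately show ?thesis
      by auto
  qed
  then have "set (map2 xor b v) \<subseteq> {0, 1, 2, 3}"
    by fastforce
  with assms show ?thesis
    by (simp add: vectors_def)
qed

lemma weight_xor: "weight w (xor x y) = xor (weight w x) (weight w y)"
  by (cases w) (simp add: bit_xor_iff xor.assoc xor.left_commute xor_cancel_left)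

lemma time_xor:
  assumes "b \<in> vectors" "v \<in> vectors"
  shows "time (map2 xor b v) = xor (time b) (time v)"
  using assms
  by (elim vectorsE)
    (simp add: time_def weights_def weight_xor xor.assoc xor.commute xor.left_commute
      del: weight.simps)

section \<open>Doubling of paths by translation\<close>

lemma xor_power_eq_add:
  fixes m :: nat
  assumes "m < 2 ^ k"
  shows "xor (2 ^ k) m = 2 ^ k + m"
proof -
  have "\<not> bit m k"
    using assms by (metis bit_take_bit_iff less_irrefl take_bit_nat_eq_self)
  then have "and (2 ^ k) m = 0"
    by (auto intro!: bit_eqI simp: bit_simps)
  then show ?thesis
    by (simp add: disjunctive_add_eq_xor)
qed

text \<open>By linearity, translation by \<open>b\<close> turns a time \<open>m < 2 ^ k\<close> into
  \<open>xor (2 ^ k) m\<close>. No carry occurs, so this is \<open>2 ^ k + m\<close>, and the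
  translates fill the next block of times.\<close>

lemma timed_double:
  assumes "timed k vs" "b \<in> vectors" "time b = 2 ^ k"
  shows "timed (Suc k) (vs @ map (map2 xor b) vs)"
proof -
  have "time (map2 xor b v) = xor (2 ^ k) (time v)" if "v \<in> set vs" for v
    using assms that by (auto simp: timed_def time_xor)
  then have "map time (map (map2 xor b) vs) = map (xor (2 ^ k)) (map time vs)"
    by simp
  also have "\<dots> = map (xor (2 ^ k)) [0..<2 ^ k]"
    using assms(1) by (simp add: timed_def)
  also have "\<dots> = [2 ^ k..<2 ^ Suc k]"
    by (rule nth_equalityI) (simp_all add: xor_power_eq_add)
  finally have "map time (vs @ map (map2 xor b) vs) = [0..<2 ^ k] @ [2 ^ k..<2 ^ Suc k]"
    using assms(1) by (simp add: timed_def)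
  also have "\<dots> = [0..<2 ^ Suc k]"
    by (simp add: mult_2 flip: upt_add_eq_append)
  finally show ?thesis
    using assms by (auto simp: timed_def xor_in_vectors)
qed

lemma timed_nonempty: "timed k vs \<Longrightarrow> vs \<noteq> []"
  by (auto simp: timed_def dest: arg_cong[where f = length])

lemma xor_zero_vector:
  assumes "b \<in> vectors"
  shows "map2 xor b [0, 0, 0, 0, 0] = b"
  using assms by (elim vectorsE) simp

lemma linear_move_xor:
  assumes "b \<in> vectors" "u \<in> vectors" "v \<in> vectors" "linear_move u v"
  shows "linear_move (map2 xor b u) (map2 xor b v)"
proof -
  have nth: "map2 xor b w ! k = xor (b ! k) (w ! k)" if "w \<in> vectors" "k < 5" for w k
    using assms(1) that by (simp add: vectors_def)
  have cancel: "xor (xor x y) (xor x z) = xor y z" for x y z :: int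
    by (simp add: xor.assoc xor.left_commute xor_cancel_left)
  obtain i j where ij: "i < 5" "j < 5" "i \<noteq> j" "xor (u ! i) (v ! i) = 2" "xor (u ! j) (v ! j) = 1"
    "\<forall>k<5. k \<noteq> i \<longrightarrow> k \<noteq> j \<longrightarrow> u ! k = v ! k"
    using assms(4) by (auto simp: linear_move_def)
  then have "xor (map2 xor b u ! i) (map2 xor b v ! i) = 2"
    "xor (map2 xor b u ! j) (map2 xor b v ! j) = 1"
    "\<forall>k<5. k \<noteq> i \<longrightarrow> k \<noteq> j \<longrightarrow> map2 xor b u ! k = map2 xor b v ! k"
    using assms(2,3) by (simp_all add: nth cancel)
  then show ?thesis
    unfolding linear_move_def using ij(1-3) by blast
qed

lemma successively_linear_move_xor:
  assumes "b \<in> vectors" "set vs \<subseteq> vectors" "successively linear_move vs"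
  shows "successively linear_move (map (map2 xor b) vs)"
  unfolding successively_map
  using assms by (auto intro: successively_mono linear_move_xor)

text \<open>
  If \<open>b\<close> is the image of \<open>2 ^ k\<close>, then translating by \<open>b\<close> the path through the times below \<open>2 ^ k\<close>
  gives the times from \<open>2 ^ k\<close> on.
\<close>

lemma linear_path_double:
  assumes "\<exists>vs. linear_path k u vs"
    and "b \<in> vectors" "time b = 2 ^ k" "linear_move u b" "v = map2 xor b u"
  shows "\<exists>vs. linear_path (Suc k) v vs"
proof -
  obtain vs where vs: "linear_path k u vs"
    using assms(1) by blast
  then have "vs \<noteq> []"
    using timed_nonempty by (auto simp: linear_path_def)
  moreover have "successively linear_move (map (map2 xor b) vs)"
    using vs assms by (auto simp: linear_path_def timed_def intro: successively_linear_move_xor)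
  \<comment> \<open>The junction runs from \<open>u\<close>, the end of \<open>vs\<close>, to
    \<open>b\<close>, the translate of the zero vector; this is the move assumed in
    \<open>linear_move u b\<close>.\<close>
  ultimately have "linear_path (Suc k) v (vs @ map (map2 xor b) vs)"
    using vs assms
    by (simp add: linear_path_def timed_double successively_append_iff hd_map last_map
        xor_zero_vector)
  then show ?thesis
    by blast
qed

lemma linear_path_9: "\<exists>vs. linear_path 9 [0, 0, 2, 1, 0] vs"
proof -
  note step = vectors_def time_def weights_def linear_move_def ex_less_5 all_less_5
  have "linear_path 0 [0, 0, 0, 0, 0] [[0, 0, 0, 0, 0]]"
    by (simp add: linear_path_def timed_def vectors_def time_def weights_def)
  then have "\<exists>vs. linear_path 0 [0, 0, 0, 0, 0] vs" ..
  \<comment> \<open>In each step the first vector is the one with time \<open>2 ^ k\<close> and the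
    second is the new end, with time \<open>2 ^ (k + 1) - 1\<close>. The new end is also the
    difference across the junction, so its nonzero entries are one 2 and one 1.\<close>
  from linear_path_double[OF this, of "[0, 2, 1, 0, 0]" "[0, 2, 1, 0, 0]"]
  have "\<exists>vs. linear_path 1 [0, 2, 1, 0, 0] vs"
    by (simp add: step flip: numeral_2_eq_2 numeral_3_eq_3)
  from linear_path_double[OF this, of "[0, 2, 1, 1, 2]" "[0, 0, 0, 1, 2]"]
  have "\<exists>vs. linear_path 2 [0, 0, 0, 1, 2] vs"
    by (simp add: step flip: numeral_2_eq_2 numeral_3_eq_3)
  from linear_path_double[OF this, of "[0, 0, 2, 1, 3]" "[0, 0, 2, 0, 1]"]
  have "\<exists>vs. linear_path 3 [0, 0, 2, 0, 1] vs"
    by (simp add: step flip: numeral_2_eq_2 numeral_3_eq_3)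
  from linear_path_double[OF this, of "[0, 1, 2, 2, 1]" "[0, 1, 0, 2, 0]"]
  have "\<exists>vs. linear_path 4 [0, 1, 0, 2, 0] vs"
    by (simp add: step flip: numeral_2_eq_2 numeral_3_eq_3)
  from linear_path_double[OF this, of "[1, 1, 2, 2, 0]" "[1, 0, 2, 0, 0]"]
  have "\<exists>vs. linear_path 5 [1, 0, 2, 0, 0] vs"
    by (simp add: step flip: numeral_2_eq_2 numeral_3_eq_3)
  from linear_path_double[OF this, of "[3, 0, 2, 1, 0]" "[2, 0, 0, 1, 0]"]
  have "\<exists>vs. linear_path 6 [2, 0, 0, 1, 0] vs"
    by (simp add: step flip: numeral_2_eq_2 numeral_3_eq_3)
  from linear_path_double[OF this, of "[0, 0, 1, 1, 0]" "[2, 0, 1, 0, 0]"]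
  have "\<exists>vs. linear_path 7 [2, 0, 1, 0, 0] vs"
    by (simp add: step flip: numeral_2_eq_2 numeral_3_eq_3)
  from linear_path_double[OF this, of "[2, 1, 1, 0, 2]" "[0, 1, 0, 0, 2]"]
  have "\<exists>vs. linear_path 8 [0, 1, 0, 0, 2] vs"
    by (simp add: step flip: numeral_2_eq_2 numeral_3_eq_3)
  from linear_path_double[OF this, of "[0, 1, 2, 1, 2]" "[0, 0, 2, 1, 0]"]
  have "\<exists>vs. linear_path 9 [0, 0, 2, 1, 0] vs"
    by (simp add: step flip: numeral_2_eq_2 numeral_3_eq_3)
  then show ?thesis .
qed

section \<open>From linear moves to the knight's tour\<close>

lemma cell_of_in_cells:
  assumes "v \<in> vectors"
  shows "cell_of v \<in> cells"
  using assms by (fastforce simp: cells_def vectors_def cell_of_def)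

lemma knight_move_linear_move:
  assumes "u \<in> vectors" "v \<in> vectors" "linear_move u v"
  shows "knight_move (cell_of u) (cell_of v)"
proof -
  have nth: "cell_of w ! k = w ! k + 1" if "w \<in> vectors" "k < 5" for w k
    using that by (simp add: vectors_def cell_of_def)
  have nth_in: "w ! k \<in> {0, 1, 2, 3}" if "w \<in> vectors" "k < 5" for w k
    using that by (metis (mono_tags, lifting) mem_Collect_eq nth_mem subsetD vectors_def)
  have "\<bar>x - y\<bar> = 2" if "xor x y = 2" "x \<in> {0, 1, 2, 3}" "y \<in> {0, 1, 2, 3}" for x y :: int
    using that by auto
  moreover have "\<bar>x - y\<bar> = 1" if "xor x y = 1" "x \<in> {0, 1, 2, 3}" "y \<in> {0, 1, 2, 3}" for x y :: int
    using that by auto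
  moreover obtain i j where ij: "i < 5" "j < 5" "i \<noteq> j" "xor (u ! i) (v ! i) = 2"
    "xor (u ! j) (v ! j) = 1" "\<forall>k<5. k \<noteq> i \<longrightarrow> k \<noteq> j \<longrightarrow> u ! k = v ! k"
    using assms(3) by (auto simp: linear_move_def)
  ultimately have "\<bar>cell_of u ! i - cell_of v ! i\<bar> = 2" "\<bar>cell_of u ! j - cell_of v ! j\<bar> = 1"
    "\<forall>k<5. k \<noteq> i \<longrightarrow> k \<noteq> j \<longrightarrow> cell_of u ! k = cell_of v ! k"
    using nth_in assms(1,2) by (simp_all add: nth del: insert_iff)
  then show ?thesis
    unfolding knight_move_def using ij(1-3) cell_of_in_cells assms(1,2) by blast
qed

lemma timed_tour: "\<exists>vs. timed 10 vs \<and> successively knight_move (map cell_of vs)"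
proof -
  let ?b = "[0, 0, 2, 2, 2] :: int list"
  obtain vs where vs: "timed 9 vs" "successively linear_move vs"
    "hd vs = [0, 0, 0, 0, 0]" "last vs = [0, 0, 2, 1, 0]"
    using linear_path_9 by (auto simp: linear_path_def)
  have b: "?b \<in> vectors" "time ?b = 2 ^ 9"
    by (simp_all add: vectors_def time_def weights_def)
  have timed: "timed (Suc 9) (vs @ map (map2 xor ?b) vs)"
    using vs(1) b by (rule timed_double)
  have knight: "successively knight_move (map cell_of ws)"
    if "set ws \<subseteq> vectors" "successively linear_move ws" for ws
    unfolding successively_map
    using that by (auto intro: successively_mono knight_move_linear_move)
  have "successively knight_move (map cell_of vs)"
    using vs by (intro knight) (simp_all add: timed_def)
  moreover have "successively knight_move (map cell_of (map (map2 xor ?b) vs))"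
    using timed vs b
    by (intro knight successively_linear_move_xor) (simp_all add: timed_def)
  \<comment> \<open>A linear move flips two bits, so from zero such moves reach only vectors with an
    even number of set bits. This junction flips three bits and leaves that hyperplane, hence the
    direct check on cells.\<close>
  moreover have "knight_move (cell_of (last vs)) (cell_of (map2 xor ?b (hd vs)))"
    by (simp add: vs cell_of_def knight_move_def cells_def ex_less_5 all_less_5)
  ultimately have "successively knight_move (map cell_of (vs @ map (map2 xor ?b) vs))"
    using timed_nonempty[OF vs(1)] by (simp add: successively_append_iff hd_map last_map)
  with timed show ?thesis
    by auto
qed

section \<open>Line sums and the magic property\<close>

lemma nat_eq_sum_bits:
  fixes x :: nat
  assumes "\<And>k. bit x k \<Longrightarrow> k < n"
  shows "x = (\<Sum>k = 0..<n. push_bit k (of_bool (bit x k)))"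
proof -
  have "take_bit n x = x"
    using assms by (auto intro!: bit_eqI simp: bit_take_bit_iff)
  then show ?thesis
    by (simp add: take_bit_sum[symmetric])
qed

text \<open>The summands form a coset of the span of \<open>p\<close> and \<open>q\<close>. Each bit
  below \<open>n\<close> is set in \<open>p\<close> or \<open>q\<close>, so exactly two of the four
  summands contain it; higher bits do not occur.\<close>

lemma sum_xor_plane:
  fixes z p q :: nat
  assumes "or p q = mask n" "z < 2 ^ n"
  shows "z + xor p z + xor q z + xor (xor p q) z = 2 * mask n"
proof -
  have pq: "bit p k \<or> bit q k \<longleftrightarrow> k < n" for k
    using arg_cong[OF assms(1), of "\<lambda>x. bit x k"] by (simp add: bit_simps)
  have z: "bit p k \<or> bit q k" if "bit z k" for k
    unfolding pq using that assms(2) by (metis bit_take_bit_iff take_bit_nat_eq_self)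
  have bits: "x = (\<Sum>k = 0..<n. push_bit k (of_bool (bit x k)))"
    if "x \<in> {z, xor p z, xor q z, xor (xor p q) z, mask n}" for x
    using that z by (intro nat_eq_sum_bits) (auto simp: bit_simps dest: z simp flip: pq)
  have "z + xor p z + xor q z + xor (xor p q) z
    = (\<Sum>k = 0..<n. push_bit k (of_bool (bit z k)) + push_bit k (of_bool (bit (xor p z) k))
        + push_bit k (of_bool (bit (xor q z) k)) + push_bit k (of_bool (bit (xor (xor p q) z) k)))"
    by (simp only: sum.distrib bits[symmetric] insert_iff simp_thms)
  also have "\<dots> = (\<Sum>k = 0..<n. 2 * push_bit k (of_bool (bit (mask n :: nat) k)))"
  proof (intro sum.cong refl)
    fix k
    assume "k \<in> {0..<n}"
    then show "push_bit k (of_bool (bit z k)) + push_bit k (of_bool (bit (xor p z) k))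
        + push_bit k (of_bool (bit (xor q z) k)) + push_bit k (of_bool (bit (xor (xor p q) z) k))
      = 2 * push_bit k (of_bool (bit (mask n :: nat) k) :: nat)"
      using pq[of k]
      by (cases "bit p k"; cases "bit q k"; cases "bit z k")
        (simp_all add: bit_simps push_bit_eq_mult)
  qed
  also have "\<dots> = 2 * mask n"
    by (simp only: sum_distrib_left[symmetric] bits[symmetric] insert_iff simp_thms)
  finally show ?thesis .
qed

lemma vector_of_cell_of [simp]: "vector_of (cell_of v) = v"
  by (simp add: cell_of_def vector_of_def comp_def)

text \<open>Linearity separates the contribution of one coordinate. The base point has coordinate 1
  because this is the zero vector in two bits.\<close>

lemma time_update:
  assumes "c \<in> cells" "i < 5"
  shows "time (vector_of (c[i := x])) =
    xor (weight (weights ! i) (x - 1)) (time (vector_of (c[i := 1])))"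
proof -
  obtain a b d e f where "c = [a, b, d, e, f]"
    using assms(1) by (auto simp: cells_def length_Suc_conv eval_nat_numeral)
  moreover have "weight w 0 = 0" for w
    by (cases w) simp
  moreover have "i \<in> {0, 1, 2, 3, 4}"
    using assms(2) by auto
  ultimately show ?thesis
    by (auto simp: time_def weights_def vector_of_def xor.assoc xor.commute xor.left_commute
        simp del: weight.simps)
qed

lemma line_eq:
  assumes "c \<in> cells" "i < 5"
  shows "{d \<in> cells. \<forall>k<5. k \<noteq> i \<longrightarrow> d ! k = c ! k} = (\<lambda>z. c[i := z]) ` {1..4}"
proof (intro equalityI subsetI)
  fix d
  assume d: "d \<in> {d \<in> cells. \<forall>k<5. k \<noteq> i \<longrightarrow> d ! k = c ! k}"
  then have "d = c[i := d ! i]"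
    using assms by (auto intro!: nth_equalityI simp: cells_def nth_list_update)
  moreover have "d ! i \<in> {1..4}"
    using d assms by (auto simp: cells_def dest!: subsetD intro: nth_mem)
  ultimately show "d \<in> (\<lambda>z. c[i := z]) ` {1..4}"
    by blast
next
  fix d
  assume "d \<in> (\<lambda>z. c[i := z]) ` {1..4}"
  then show "d \<in> {d \<in> cells. \<forall>k<5. k \<noteq> i \<longrightarrow> d ! k = c ! k}"
    using assms set_update_subset_insert[of c i] by (fastforce simp: cells_def)
qed

lemma timed_tour_magic:
  assumes "timed 10 vs"
  shows "distinct (map cell_of vs)" "set (map cell_of vs) = cells" "magic (map cell_of vs)"
proof -
  let ?t = "map cell_of vs"
  have times: "map (time \<circ> vector_of) ?t = [0..<1024]"
    using assms by (simp add: timed_def comp_def)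
  have length: "length ?t = 1024"
    using arg_cong[OF times, of length] by simp
  show distinct: "distinct ?t"
    by (metis distinct_map distinct_upt times)
  \<comment> \<open>Every cell is visited by counting: 1024 distinct entries among
    \<open>4 ^ 5\<close> cells.\<close>
  have "card cells = 1024"
    using card_lists_length_eq[of "{1..4::int}" 5] by (simp add: cells_def conj_commute)
  moreover from this have "finite cells"
    using card.infinite by fastforce
  moreover have "set ?t \<subseteq> cells"
    using assms by (auto simp: timed_def cell_of_in_cells)
  moreover have "card (set ?t) = 1024"
    using distinct_card[OF distinct] length by simp
  ultimately show set: "set ?t = cells"
    by (simp add: card_subset_eq)
  have time: "time (vector_of c) < 1024 \<and> cell_number ?t c = Suc (time (vector_of c))"
    if "c \<in> cells" for c
  proof -
    have "c \<in> set ?t"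
      unfolding set by (rule that)
    then obtain k where k: "k < length ?t" "c = ?t ! k"
      unfolding in_set_conv_nth by blast
    have "inv_into {..<length ?t} ((!) ?t) c = k"
      unfolding k(2) using k(1) distinct by (intro inv_into_f_f inj_on_nth) auto
    moreover have "time (vector_of c) = k"
      using k arg_cong[OF times, of "\<lambda>ns. ns ! k"] length by simp
    ultimately show ?thesis
      using k(1) length by (simp add: cell_number_def)
  qed
  show "magic ?t"
    unfolding magic_def
  proof (intro exI ballI)
    fix L
    assume "L \<in> lines"
    then obtain c i where c: "c \<in> cells" and i: "i < 5"
      and L: "L = (\<lambda>x. c[i := x]) ` {1..4}"
      using line_eq by (auto simp: lines_def)
    have in_cells: "c[i := x] \<in> cells" if "x \<in> {1..4}" for x
      using line_eq[OF c i] that by blast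
    have inj: "inj_on (\<lambda>x. c[i := x]) {1..4}"
      using c i by (intro inj_on_inverseI[where g = "\<lambda>d. d ! i"]) (simp add: cells_def)
    obtain p q where pq: "weights ! i = (p, q)"
      by fastforce
    define z where "z = time (vector_of (c[i := 1]))"
    have "i \<in> {0, 1, 2, 3, 4}"
      using i by auto
    then have "or p q = mask 10"
      using pq by (auto simp: weights_def mask_eq_exp_minus_1)
    moreover have "z < 2 ^ 10"
      using time in_cells by (simp add: z_def)
    ultimately have plane: "z + xor p z + xor q z + xor (xor p q) z = 2046"
      using sum_xor_plane[of p q 10 z] by (simp add: mask_eq_exp_minus_1)
    have "(\<Sum>d\<in>L. cell_number ?t d) = (\<Sum>x\<in>{1..4}. Suc (time (vector_of (c[i := x]))))"
      unfolding L sum.reindex[OF inj] comp_def using time in_cells by (intro sum.cong) simp_all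
    also have "\<dots> = (\<Sum>x\<in>{1..4}. Suc (xor (weight (p, q) (x - 1)) z))"
      unfolding z_def using time_update[OF c i] pq
      by (intro sum.cong refl arg_cong[where f = Suc]) metis
    also have "{1..4} = {1, 2, 3, 4::int}"
      by auto
    \<comment> \<open>The four times sum to \<open>2 * 1023 = 2046\<close>, and numbering from 1
      adds 4.\<close>
    also have "(\<Sum>x\<in>{1, 2, 3, 4}. Suc (xor (weight (p, q) (x - 1)) z)) = 2050"
      using plane by simp
    finally show "(\<Sum>d\<in>L. cell_number ?t d) = 2050" .
  qed
qed

theorem mainTheorem4: "\<exists>t. knights_tour t \<and> magic t"
  using timed_tour timed_tour_magic unfolding knights_tour_def by blast

end
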